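(* Let $1\leq k<\ell$ be integers and let $G$ be a compact abelian group of the form $G=\mathbb{I}\times M$, where $\mathbb{I}$ is the identity component of $G$. Then $$\lambda_{k,\ell}(G)\leq\max\left\{\lambda_{k,\ell}(M),\frac{1}{k+\ell}\right\}.$$
   Context: For a subset $A$ of an abelian group and a positive integer $k$, $kA=\{a_1+\cdots+a_k: a_i\in A\}$ denotes the $k$-fold Minkowski sum. For a compact abelian group $G$ with Haar probability measure $\mu$ (normalized so $\mu(G)=1$), $\lambda_{k,\ell}(G)=\sup\{\mu(A): A\subseteq G \text{ measurable},\ kA\cap\ell A=\emptyset\}$; $M$ is likewise a compact abelian group with its own Haar probability measure. *)

theory Defs
  imports "HOL-Analysis.Analysis"
begin

definition ksum :: "nat \<Rightarrow> 'a::comm_monoid_add set \<Rightarrow> 'a set" where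
  "ksum k A = {(\<Sum>i<k. a i) | a. \<forall>i<k. a i \<in> A}"

(* Regularity is automatic on a compact metrizable group; in general it is part of the
   definition of Haar measure and is what makes it unique.  For a finite measure,
   inner regularity on all Borel sets is equivalent to the usual
   outer/inner regularity conditions. *)
definition haar_prob :: "'a::{topological_ab_group_add, t2_space} measure \<Rightarrow> bool" where
  "haar_prob \<mu> \<longleftrightarrow>
     sets \<mu> = sets borel \<and>
     emeasure \<mu> UNIV = 1 \<and>
     (\<forall>x. \<forall>A\<in>sets borel. emeasure \<mu> ((+) x ` A) = emeasure \<mu> A) \<and>
     (\<forall>A\<in>sets borel. emeasure \<mu> A = (SUP K\<in>{K. compact K \<and> K \<subseteq> A}. emeasure \<mu> K))"

(* The group is the type 'a and \<mu> is its Haar probability measure.  The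
   supremum is over a nonempty set when k or l is positive (take A empty), and
   is bounded by 1. *)
definition lambda_kl ::
  "nat \<Rightarrow> nat \<Rightarrow> 'a::{topological_ab_group_add, t2_space} measure \<Rightarrow> real" where
  "lambda_kl k l \<mu> = Sup {measure \<mu> A | A. A \<in> sets \<mu> \<and> ksum k A \<inter> ksum l A = {}}"

definition identity_component :: "'a::topological_ab_group_add set" where
  "identity_component = connected_component_set UNIV 0"

(* The type 'g is, as a topological group, the direct product of its
   identity component and 'm: the isomorphism \<phi> carries the identity component
   onto the first factor. *)
definition splits_as_component_times ::
  "('g::topological_ab_group_add \<Rightarrow> 'g \<times> 'm::topological_ab_group_add) \<Rightarrow> bool" where
  "splits_as_component_times \<phi> \<longleftrightarrow>
     (\<exists>\<psi>. homeomorphism UNIV (identity_component \<times> UNIV) \<phi> \<psi>) \<and>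
     (\<forall>x y. \<phi> (x + y) = \<phi> x + \<phi> y) \<and>
     \<phi> ` identity_component = identity_component \<times> {0}"

end

theory Submission
  imports Defs
begin

text \<open>
  The key is a weak form of Kneser's theorem: for compact \<open>A\<close> and \<open>B\<close>, either
  \<open>\<mu>(A + B) \<ge> \<mu>(A) + \<mu>(B)\<close> or \<open>A + B\<close> is open. To see this near a point \<open>a + b\<close> of \<open>A + B\<close>,
  translate so that \<open>b = 0\<close> and apply Dyson transforms
  \<open>(A, B) \<mapsto> (A \<union> (B + e), B \<inter> (A - e))\<close> with \<open>e \<in> A\<close>, which preserve \<open>\<mu>(A) + \<mu>(B)\<close>, do not
  enlarge the sumset, and keep \<open>0 \<in> B\<close>. By Zorn's lemma there is a terminal pair, and it
  satisfies \<open>A + B \<subseteq> A\<close>. If \<open>B\<close> is null, the inequality follows; otherwise \<open>A\<close> is stable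
  under \<open>B - B\<close>, a neighbourhood of \<open>0\<close> by Steinhaus, hence open.

  Let now \<open>kA \<inter> \<ell>A = \<emptyset>\<close>. If neither \<open>kA\<close> nor \<open>\<ell>A\<close> is open, then \<open>(k + \<ell>) \<mu>(A) \<le> 1\<close>. If, say,
  \<open>kA\<close> is open, then its stabilizer \<open>H\<close> is an open subgroup and so contains the identity
  component. Enlarging \<open>A\<close> to \<open>A + H\<close> keeps it sum-free, and \<open>A + H\<close> is the preimage of a
  sum-free subset of \<open>M\<close> of the same measure, as one sees by counting cosets.
\<close>

section \<open>Translates and sumsets in topological abelian groups\<close>

lemma image_plus_eq_vimage: "(+) x ` A = (\<lambda>y. y - x) -` (A :: 'a::ab_group_add set)"
proof -
  have "y \<in> (+) x ` A" if "y - x \<in> A" for y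
    using that by (intro image_eqI[of _ _ "y - x"]) auto
  then show ?thesis by auto
qed

lemma mem_image_plus_iff: "y \<in> (+) x ` A \<longleftrightarrow> y - x \<in> (A :: 'a::ab_group_add set)"
  by (simp add: image_plus_eq_vimage)

lemma open_image_plus: "open A \<Longrightarrow> open ((+) x ` (A :: 'a::topological_ab_group_add set))"
  unfolding image_plus_eq_vimage by (intro open_vimage continuous_intros)

lemma closed_image_plus: "closed A \<Longrightarrow> closed ((+) x ` (A :: 'a::topological_ab_group_add set))"
  unfolding image_plus_eq_vimage by (intro closed_vimage continuous_intros)

lemma compact_image_plus: "compact A \<Longrightarrow> compact ((+) x ` (A :: 'a::topological_ab_group_add set))"
  by (intro compact_continuous_image continuous_intros)

lemma borel_image_plus:
  "A \<in> sets borel \<Longrightarrow> (+) x ` (A :: 'a::topological_ab_group_add set) \<in> sets borel"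
proof -
  assume A: "A \<in> sets borel"
  have "(\<lambda>y. y - x) \<in> borel_measurable borel"
    by (intro borel_measurable_continuous_onI continuous_intros)
  from measurable_sets[OF this A] show ?thesis
    by (simp add: image_plus_eq_vimage)
qed

lemma compact_set_plus:
  fixes A B :: "'a::topological_ab_group_add set"
  assumes "compact A" "compact B"
  shows "compact (A + B)"
proof -
  have "A + B = (\<lambda>(a, b). a + b) ` (A \<times> B)"
    by (auto simp: set_plus_def)
  moreover have "continuous_on (A \<times> B) (\<lambda>(a, b). a + b)"
    by (auto simp: case_prod_beta intro!: continuous_intros)
  ultimately show ?thesis
    using assms by (simp add: compact_Times compact_continuous_image)
qed

lemma open_set_plus:
  fixes A B :: "'a::topological_ab_group_add set"
  assumes "open B"
  shows "open (A + B)"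
proof -
  have "A + B = (\<Union>a\<in>A. (+) a ` B)"
    by (auto simp: set_plus_def)
  then show ?thesis
    using assms by (auto intro: open_image_plus)
qed

section \<open>Haar probability on a compact group: regularity and compactness arguments\<close>

locale compact_haar =
  fixes \<mu> :: "'a::{topological_ab_group_add, t2_space} measure"
  assumes compact_UNIV: "compact (UNIV :: 'a set)"
    and haar: "haar_prob \<mu>"
begin

lemma sets_eq [simp]: "sets \<mu> = sets borel"
  using haar by (simp add: haar_prob_def)

lemma space_eq [simp]: "space \<mu> = UNIV"
  using sets_eq_imp_space_eq[OF sets_eq] by simp

sublocale finite_measure \<mu>
  using haar by (intro finite_measureI) (simp add: haar_prob_def)

lemma measure_UNIV [simp]: "measure \<mu> UNIV = 1"
  using haar by (simp add: haar_prob_def measure_def)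

lemma measure_image_plus: "A \<in> sets borel \<Longrightarrow> measure \<mu> ((+) x ` A) = measure \<mu> A"
  using haar by (simp add: haar_prob_def measure_def)

lemma measure_le_1: "A \<in> sets borel \<Longrightarrow> measure \<mu> A \<le> 1"
  using bounded_measure[of A] by simp

lemma closed_imp_compact: "closed A \<Longrightarrow> compact (A :: 'a set)"
  using compact_Int_closed[OF compact_UNIV] by simp

lemma inner_regular:
  assumes A: "A \<in> sets borel" and "e > 0"
  obtains K where "compact K" "K \<subseteq> A" "measure \<mu> A < measure \<mu> K + e"
proof -
  have eq: "emeasure \<mu> A = (SUP K\<in>{K. compact K \<and> K \<subseteq> A}. emeasure \<mu> K)"
    using haar A by (auto simp: haar_prob_def)
  show thesis
  \<comment> \<open>Null sets are treated apart because \<open>ennreal\<close> truncates negative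
    reals to 0, which would spoil the strict inequality below.\<close>
  proof (cases "measure \<mu> A = 0")
    case True
    then show ?thesis using that[of "{}"] \<open>e > 0\<close> by simp
  next
    case False
    then have "ennreal (measure \<mu> A - e) < emeasure \<mu> A"
      using \<open>e > 0\<close> unfolding emeasure_eq_measure
      by (intro ennreal_lessI) (auto simp: zero_less_measure_iff)
    then obtain K where K: "compact K" "K \<subseteq> A" "ennreal (measure \<mu> A - e) < emeasure \<mu> K"
      unfolding eq less_SUP_iff by auto
    have "measure \<mu> A - e < measure \<mu> K"
      using K(3) unfolding emeasure_eq_measure
      by (metis ennreal_leI not_le)
    with that[of K] K show ?thesis by auto
  qed
qed

text \<open>Inner regularity applied to \<open>- K\<close>: the complement of a nearly full compact
  subset is open and barely larger than \<open>K\<close>.\<close>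

lemma outer_regular:
  assumes "closed K" and "e > 0"
  obtains U where "open U" "K \<subseteq> U" "measure \<mu> U < measure \<mu> K + e"
proof -
  have "- K \<in> sets borel" using assms by auto
  then obtain L where L: "compact L" "L \<subseteq> - K" "measure \<mu> (- K) < measure \<mu> L + e"
    using inner_regular assms(2) by blast
  have compl: "measure \<mu> (- X) = 1 - measure \<mu> X" if "closed X" for X
    using finite_measure_compl[of X] that by (simp add: Compl_eq_Diff_UNIV)
  have "closed L" using L(1) by (rule compact_imp_closed)
  show thesis
    by (rule that[of "- L"]) (use L \<open>closed L\<close> assms(1) in \<open>auto simp: compl\<close>)
qed

text \<open>A point \<open>v\<close> moves some \<open>b\<close> of \<open>B\<close> out of
  \<open>U\<close> exactly when it is a difference of a point of \<open>- U\<close> and a point of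
  \<open>B\<close>. Such differences form a sum of two compact sets, hence a closed set; it misses
  0, so its complement serves as \<open>V\<close>.\<close>

lemma exists_nhd_plus_subset:
  fixes B U :: "'a set"
  assumes "compact B" "open U" "B \<subseteq> U"
  obtains V where "open V" "0 \<in> V" "V + B \<subseteq> U"
proof -
  have "compact (uminus ` B)"
    using assms(1) by (intro compact_continuous_image continuous_intros)
  then have "closed (- U + uminus ` B)"
    using compact_imp_closed[OF compact_set_plus[OF closed_imp_compact]] assms(2)
    by (simp add: closed_Compl)
  moreover have "0 \<notin> - U + uminus ` B"
    using assms(3) by (auto simp: set_plus_def)
  moreover have "v + b \<in> U" if "v \<notin> - U + uminus ` B" "b \<in> B" for v b
  proof (rule ccontr)
    assume "v + b \<notin> U"
    then have "(v + b) + (- b) \<in> - U + uminus ` B"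
      using that(2) by (intro set_plus_intro) auto
    then show False using that(1) by simp
  qed
  ultimately show thesis
    by (intro that[of "- (- U + uminus ` B)"]) (simp_all add: open_Compl, blast elim: set_plus_elim)
qed

text \<open>Continuity from above for chains that may be uncountable, as they occur in Zorn's lemma.
  By compactness some member of the chain already lies in an open set barely larger than the
  intersection.\<close>

lemma measure_Inter_chain:
  assumes "C \<noteq> {}" and cl: "\<And>B. B \<in> C \<Longrightarrow> closed B"
    and chain: "\<And>A B. A \<in> C \<Longrightarrow> B \<in> C \<Longrightarrow> A \<subseteq> B \<or> B \<subseteq> A" and "e > 0"
  obtains B where "B \<in> C" "measure \<mu> B < measure \<mu> (\<Inter>C) + e"
proof -
  have "closed (\<Inter>C)" using cl by auto
  then obtain U where U: "open U" "\<Inter>C \<subseteq> U" "measure \<mu> U < measure \<mu> (\<Inter>C) + e"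
    using outer_regular \<open>e > 0\<close> by blast
  have "compact (- U)" using U(1) by (intro closed_imp_compact) auto
  moreover have "- U \<inter> \<Inter>C = {}" using U(2) by auto
  ultimately obtain F where F: "finite F" "F \<subseteq> C" "- U \<inter> \<Inter>F = {}"
    using compact_imp_fip[of "- U" C] cl by metis
  \<comment> \<open>A minimal member of the finite chain \<open>F\<close> lies in
    \<open>\<Inter>F\<close>. If \<open>F\<close> is empty, \<open>U\<close> is the whole group and
    any member of \<open>C\<close> will do.\<close>
  obtain B where "B \<in> C" "B \<subseteq> U"
  proof (cases "F = {}")
    case True
    then show thesis using F(3) \<open>C \<noteq> {}\<close> that by auto
  next
    case False
    then obtain B where B: "B \<in> F" "\<And>X. X \<in> F \<Longrightarrow> X \<subseteq> B \<Longrightarrow> B = X"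
      using finite_has_minimal[OF F(1)] by metis
    then have "B \<subseteq> \<Inter>F" using chain F(2) by blast
    with F(2,3) B(1) that show thesis by blast
  qed
  moreover from this have "measure \<mu> B \<le> measure \<mu> U"
    using U(1) by (intro finite_measure_mono) auto
  ultimately show thesis using that U(3) by auto
qed


section \<open>Differences: recurrence of multiples, Steinhaus, and openness of stable sets\<close>

lemma exists_nhd_diff_subset:
  fixes U :: "'a set"
  assumes "open U" "0 \<in> U"
  obtains V where "open V" "0 \<in> V" "\<And>x y. x \<in> V \<Longrightarrow> y \<in> V \<Longrightarrow> x - y \<in> U"
proof -
  have "open ((\<lambda>p. fst p - snd p) -` U)"
    using assms(1) by (intro open_vimage continuous_intros)
  moreover have "(0, 0) \<in> (\<lambda>p. fst p - snd p) -` U"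
    using assms(2) by simp
  ultimately obtain X Y where "open X" "open Y" "(0, 0) \<in> X \<times> Y" "X \<times> Y \<subseteq> (\<lambda>p. fst p - snd p) -` U"
    by (rule open_prod_elim)
  then show thesis
    by (intro that[of "X \<inter> Y"]) auto
qed

lemma finite_translate_cover:
  fixes V :: "'a set"
  assumes "open V" "0 \<in> V"
  obtains F where "finite F" "(\<Union>x\<in>F. (+) x ` V) = UNIV"
proof -
  have "x \<in> (+) x ` V" for x
    using assms(2) by (simp add: mem_image_plus_iff)
  then have "UNIV \<subseteq> (\<Union>x. (+) x ` V)" by blast
  with compactE_image[OF compact_UNIV, of UNIV "\<lambda>x. (+) x ` V"] show thesis
    using open_image_plus[OF assms(1)] that by (metis top.extremum_uniqueI)
qed

text \<open>In a compact group some positive multiple of \<open>h\<close> is close to \<open>0\<close>, so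
  \<open>- h\<close> is a limit of multiples of \<open>h\<close>.\<close>

lemma diff_mem_of_plus_mem:
  fixes A :: "'a set"
  assumes "closed A" and plus: "\<And>a. a \<in> A \<Longrightarrow> a + h \<in> A" and "a \<in> A"
  shows "a - h \<in> A"
proof (rule ccontr)
  assume not: "a - h \<notin> A"
  define p where "p n = (\<Sum>i<n::nat. h)" for n
  have mult: "a + p n \<in> A" for n
    by (induction n) (use \<open>a \<in> A\<close> in \<open>auto simp: p_def add.assoc[symmetric] intro: plus\<close>)
  have p_add: "p (m + n) = p m + p n" for m n
    by (induction n) (auto simp: p_def add.assoc)
  \<comment> \<open>This translate consists of the \<open>u\<close> with \<open>a - h + u\<close>
    outside \<open>A\<close>.\<close>
  have "open ((+) (- (a - h)) ` (- A))" "0 \<in> (+) (- (a - h)) ` (- A)"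
    using \<open>closed A\<close> not by (auto simp: open_Compl mem_image_plus_iff intro!: open_image_plus)
  then obtain V where V: "open V" "0 \<in> V"
    "\<And>x y. x \<in> V \<Longrightarrow> y \<in> V \<Longrightarrow> x - y \<in> (+) (- (a - h)) ` (- A)"
    using exists_nhd_diff_subset by blast
  obtain F where F: "finite F" "(\<Union>x\<in>F. (+) x ` V) = UNIV"
    using finite_translate_cover[OF V(1,2)] .
  then have "\<exists>x. x \<in> F \<and> p n \<in> (+) x ` V" for n
    by blast
  then obtain c where c: "c n \<in> F" "p n \<in> (+) (c n) ` V" for n
    by metis
  \<comment> \<open>Pigeonhole: two multiples \<open>p m\<close> and \<open>p n\<close> land in the
    same translate of \<open>V\<close>. With \<open>n = m + Suc j\<close>, adding their difference
    \<open>p (Suc j)\<close> to \<open>a - h\<close> gives \<open>a + p j\<close>, which then falls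
    outside \<open>A\<close>.\<close>
  have "\<not> inj c"
    using F(1) c(1) by (metis finite_subset image_subsetI infinite_UNIV_nat finite_imageD)
  then obtain m n where mn: "m < n" "c m = c n"
    unfolding inj_def by (metis linorder_neqE_nat)
  obtain j where j: "n = m + Suc j"
    using mn(1) less_iff_Suc_add by auto
  have "(p n - c n) - (p m - c n) \<in> (+) (- (a - h)) ` (- A)"
    using c(2)[of n] c(2)[of m] mn(2) by (intro V(3)) (auto simp: mem_image_plus_iff)
  moreover have "p n - c n - (p m - c n) - (- (a - h)) = a + p j"
    unfolding j p_add by (simp add: p_def)
  ultimately have "a + p j \<notin> A"
    unfolding mem_image_plus_iff by (metis ComplD)
  then show False using mult by simp
qed

text \<open>A form of Steinhaus's theorem. If \<open>v + B\<close> missed \<open>B\<close>, their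
  union would have twice the measure of \<open>B\<close>, yet for small \<open>v\<close> both lie in
  an open set of smaller measure.\<close>

lemma diff_nhd_of_measure_pos:
  fixes B :: "'a set"
  assumes "compact B" "measure \<mu> B > 0"
  obtains V where "open V" "0 \<in> V" "\<And>v. v \<in> V \<Longrightarrow> \<exists>b\<in>B. v + b \<in> B"
proof -
  have "closed B" using assms(1) by (rule compact_imp_closed)
  obtain U where U: "open U" "B \<subseteq> U" "measure \<mu> U < measure \<mu> B + measure \<mu> B"
    using outer_regular[OF \<open>closed B\<close> assms(2)] .
  obtain V where V: "open V" "0 \<in> V" "V + B \<subseteq> U"
    using exists_nhd_plus_subset[OF assms(1) U(1,2)] .
  have "\<exists>b\<in>B. v + b \<in> B" if "v \<in> V" for v
  proof (rule ccontr)
    assume "\<not> ?thesis"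
    then have "B \<inter> (+) v ` B = {}" by auto
    moreover have meas: "B \<in> sets borel" "(+) v ` B \<in> sets borel"
      using \<open>closed B\<close> by (auto intro: borel_image_plus)
    ultimately have "measure \<mu> (B \<union> (+) v ` B) = measure \<mu> B + measure \<mu> B"
      using finite_measure_Union[of B "(+) v ` B"] by (simp add: measure_image_plus)
    moreover have "(+) v ` B \<subseteq> U"
      using V(3) that by auto
    then have "measure \<mu> (B \<union> (+) v ` B) \<le> measure \<mu> U"
      using U(1,2) by (intro finite_measure_mono) auto
    ultimately show False using U(3) by simp
  qed
  with V(1,2) show thesis by (rule that)
qed

text \<open>Being closed and stable under adding \<open>B\<close>, the set \<open>A\<close> is
  stable under subtracting it by \<open>diff_mem_of_plus_mem\<close>, hence under adding a
  neighbourhood of 0 made of differences of points of \<open>B\<close>.\<close>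

lemma open_of_plus_subset:
  fixes A B :: "'a set"
  assumes "compact A" "compact B" "A + B \<subseteq> A" "measure \<mu> B > 0"
  shows "open A"
proof -
  obtain V where V: "open V" "0 \<in> V" "\<And>v. v \<in> V \<Longrightarrow> \<exists>b\<in>B. v + b \<in> B"
    using diff_nhd_of_measure_pos[OF assms(2,4)] by metis
  have "a + v \<in> A" if "a \<in> A" "v \<in> V" for a v
  proof -
    obtain b where b: "b \<in> B" "v + b \<in> B" using V(3) \<open>v \<in> V\<close> by blast
    have "a + (v + b) \<in> A"
      using assms(3) b(2) \<open>a \<in> A\<close> by blast
    then have "a + (v + b) - b \<in> A"
      using assms(3) b(1) compact_imp_closed[OF assms(1)]
      by (intro diff_mem_of_plus_mem) auto
    then show ?thesis by (simp add: add.assoc[symmetric])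
  qed
  then have "A + V \<subseteq> A" by (auto elim!: set_plus_elim)
  moreover have "A \<subseteq> A + V"
    using set_zero_plus2[OF V(2)] by (simp add: add.commute)
  ultimately show ?thesis
    using open_set_plus[OF V(1)] by (metis subset_antisym)
qed

section \<open>Dyson transforms and the weak form of Kneser's theorem\<close>

lemma measure_transform:
  fixes A B :: "'a set"
  assumes "compact A" "compact B"
  shows "measure \<mu> (A \<union> (+) e ` B) + measure \<mu> (B \<inter> (+) (- e) ` A) = measure \<mu> A + measure \<mu> B"
proof -
  have meas: "A \<in> sets borel" "B \<in> sets borel" "(+) e ` B \<in> sets borel"
    using assms by (simp_all add: borel_image_plus borel_closed compact_imp_closed)
  \<comment> \<open>Up to translation by \<open>e\<close>, the second set of the transform is the
    intersection of \<open>A\<close> with \<open>e + B\<close>, so the claim becomes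
    inclusion-exclusion.\<close>
  have "(+) (- e) ` (A \<inter> (+) e ` B) = B \<inter> (+) (- e) ` A"
    by (auto simp: mem_image_plus_iff)
  then have "measure \<mu> (B \<inter> (+) (- e) ` A) = measure \<mu> (A \<inter> (+) e ` B)"
    using measure_image_plus[of "A \<inter> (+) e ` B" "- e"] meas by simp
  moreover have "measure \<mu> (A \<union> (+) e ` B) + measure \<mu> (A \<inter> (+) e ` B) = measure \<mu> A + measure \<mu> ((+) e ` B)"
    using measure_Un3[where M = \<mu>, of A "(+) e ` B"] meas by (simp add: fmeasurable_eq_sets)
  ultimately show ?thesis
    using meas by (simp add: measure_image_plus)
qed

text \<open>Pairs that a sequence of Dyson transforms may reach. The marked point \<open>a\<close> of \<open>S\<close> is kept
  throughout, so that the final pair still says something about \<open>S\<close> near \<open>a\<close>.\<close>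

definition admissible :: "'a set \<Rightarrow> real \<Rightarrow> 'a \<Rightarrow> ('a set \<times> 'a set) set" where
  "admissible S c a = {(A, B). compact A \<and> compact B \<and> a \<in> A \<and> 0 \<in> B \<and> A + B \<subseteq> S \<and>
     c \<le> measure \<mu> A + measure \<mu> B}"

text \<open>The upper bound for Zorn's lemma. The measure bound survives because some second
  component is almost as small as the intersection, while its partner lies inside the union.\<close>

lemma admissible_chain_bound:
  assumes "closed S" "C \<noteq> {}" "C \<subseteq> admissible S c a"
    and chain: "\<And>A B A' B'. (A, B) \<in> C \<Longrightarrow> (A', B') \<in> C \<Longrightarrow>
      A \<subseteq> A' \<and> B' \<subseteq> B \<or> A' \<subseteq> A \<and> B \<subseteq> B'"
  shows "(closure (\<Union>(fst ` C)), \<Inter>(snd ` C)) \<in> admissible S c a"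
proof -
  let ?A = "\<Union>(fst ` C)" and ?B = "\<Inter>(snd ` C)"
  have C: "compact A" "compact B" "closed B" "a \<in> A" "0 \<in> B" "A + B \<subseteq> S"
    "c \<le> measure \<mu> A + measure \<mu> B" if "(A, B) \<in> C" for A B
    using that assms(3) by (auto simp: admissible_def intro: compact_imp_closed)
  have "closed ?B" using C(3) by auto
  \<comment> \<open>Being closed, this set contains the closure of the union as soon as it contains
    the union itself.\<close>
  have "closed {x. \<forall>b\<in>?B. x + b \<in> S}"
  proof -
    have "closed {x. x + b \<in> S}" for b
      using closed_vimage[OF assms(1), of "\<lambda>x. x + b"]
      by (simp add: vimage_def continuous_on_add)
    then show ?thesis by (simp add: Ball_def closed_Collect_all closed_Collect_imp)
  qed
  moreover have "?A \<subseteq> {x. \<forall>b\<in>?B. x + b \<in> S}"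
  proof clarsimp
    fix x A B b assume *: "(A, B) \<in> C" "x \<in> A" "\<forall>p\<in>C. b \<in> snd p"
    then have "x + b \<in> A + B" by force
    then show "x + b \<in> S" using C(6)[OF *(1)] by auto
  qed
  ultimately have "closure ?A \<subseteq> {x. \<forall>b\<in>?B. x + b \<in> S}"
    by (rule closure_minimal[rotated])
  then have "closure ?A + ?B \<subseteq> S"
    by (auto elim!: set_plus_elim)
  moreover have "c \<le> measure \<mu> (closure ?A) + measure \<mu> ?B"
  proof (rule field_le_epsilon)
    fix e :: real assume "e > 0"
    obtain B where B: "B \<in> snd ` C" "measure \<mu> B < measure \<mu> ?B + e"
    proof (rule measure_Inter_chain)
      show "snd ` C \<noteq> {}" using \<open>C \<noteq> {}\<close> by simp
      show "closed B" if "B \<in> snd ` C" for B using that C(3) by auto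
      show "B \<subseteq> B' \<or> B' \<subseteq> B" if BB: "B \<in> snd ` C" "B' \<in> snd ` C" for B B'
      proof -
        from BB obtain A A' where "(A, B) \<in> C" "(A', B') \<in> C" by auto
        then show ?thesis using chain by blast
      qed
    qed (use \<open>e > 0\<close> in auto)
    then obtain A where AB: "(A, B) \<in> C" by auto
    have "A \<subseteq> ?A" using AB by force
    then have "A \<subseteq> closure ?A" using closure_subset by blast
    then have "measure \<mu> A \<le> measure \<mu> (closure ?A)"
      by (intro finite_measure_mono) auto
    then show "c \<le> measure \<mu> (closure ?A) + measure \<mu> ?B + e"
      using C(7)[OF AB] B(2) by linarith
  qed
  moreover have "a \<in> closure ?A"
  proof (rule subsetD[OF closure_subset])
    show "a \<in> ?A" using C(4) \<open>C \<noteq> {}\<close> by fastforce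
  qed
  moreover have "0 \<in> ?B" using C(5) by auto
  moreover have "compact (closure ?A)" "compact ?B"
    using \<open>closed ?B\<close> by (simp_all only: closed_imp_compact closed_closure)
  ultimately show ?thesis
    by (simp only: admissible_def mem_Collect_eq prod.case)
qed

lemma admissible_maximal:
  assumes "closed S" "(A\<^sub>0, B\<^sub>0) \<in> admissible S c a"
  obtains A B where "(A, B) \<in> admissible S c a"
    "\<And>A' B'. (A', B') \<in> admissible S c a \<Longrightarrow> A \<subseteq> A' \<Longrightarrow> B' \<subseteq> B \<Longrightarrow> A' = A \<and> B' = B"
proof -
  \<comment> \<open>Along a Dyson transform the first set grows while the second shrinks; the order
    follows this.\<close>
  define P where "P p q \<longleftrightarrow> fst p \<subseteq> fst q \<and> snd q \<subseteq> snd p" for p q :: "'a set \<times> 'a set"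
  have "\<exists>m\<in>admissible S c a. \<forall>q\<in>admissible S c a. P m q \<longrightarrow> q = m"
  proof (rule predicate_Zorn)
    show "partial_order_on (admissible S c a) (relation_of P (admissible S c a))"
      by (rule partial_order_on_relation_ofI) (auto simp: P_def)
    fix C assume C: "C \<in> Chains (relation_of P (admissible S c a))"
    then have sub: "C \<subseteq> admissible S c a"
      unfolding Chains_def relation_of_def by blast
    have ch: "P p q \<or> P q p" if "p \<in> C" "q \<in> C" for p q
      using that C unfolding Chains_def relation_of_def by blast
    show "\<exists>u\<in>admissible S c a. \<forall>p\<in>C. P p u"
    proof (cases "C = {}")
      case True
      then show ?thesis using assms(2) by auto
    next
      case False
      show ?thesis
      proof
        show "(closure (\<Union>(fst ` C)), \<Inter>(snd ` C)) \<in> admissible S c a"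
        proof (rule admissible_chain_bound[OF assms(1) False sub])
          fix A B A' B' assume "(A, B) \<in> C" "(A', B') \<in> C"
          from ch[OF this] show "A \<subseteq> A' \<and> B' \<subseteq> B \<or> A' \<subseteq> A \<and> B \<subseteq> B'"
            by (simp add: P_def)
        qed
        show "\<forall>p\<in>C. P p (closure (\<Union>(fst ` C)), \<Inter>(snd ` C))"
          using closure_subset[of "\<Union>(fst ` C)"] unfolding P_def by fastforce
      qed
    qed
  qed
  then obtain m where m: "m \<in> admissible S c a" "\<And>q. q \<in> admissible S c a \<Longrightarrow> P m q \<Longrightarrow> q = m"
    by blast
  show thesis
  proof (rule that[of "fst m" "snd m"])
    fix A' B' assume "(A', B') \<in> admissible S c a" "fst m \<subseteq> A'" "B' \<subseteq> snd m"
    with m(2)[of "(A', B')"] show "A' = fst m \<and> B' = snd m"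
      by (auto simp: P_def)
  qed (use m(1) in simp)
qed

text \<open>The dichotomy localized at \<open>a\<close>. A maximal pair satisfies
  \<open>X + Y \<subseteq> X\<close> and \<open>X \<subseteq> S\<close>: if \<open>Y\<close> has
  positive measure, \<open>X\<close> is the required neighbourhood; if \<open>Y\<close> is null,
  \<open>X\<close> alone has measure at least \<open>c\<close>.\<close>

lemma measure_set_plus_or_nhd:
  fixes A B S :: "'a set"
  assumes "compact A" "compact B" "a \<in> A" "0 \<in> B" "A + B \<subseteq> S" "closed S"
  shows "measure \<mu> A + measure \<mu> B \<le> measure \<mu> S \<or> (\<exists>N. open N \<and> a \<in> N \<and> N \<subseteq> S)"
proof -
  define c where "c = measure \<mu> A + measure \<mu> B"
  have "(A, B) \<in> admissible S c a"
    using assms by (simp add: admissible_def c_def)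
  from admissible_maximal[OF \<open>closed S\<close> this] obtain X Y where XY: "(X, Y) \<in> admissible S c a"
    and max: "\<And>A' B'. (A', B') \<in> admissible S c a \<Longrightarrow> X \<subseteq> A' \<Longrightarrow> B' \<subseteq> Y \<Longrightarrow> A' = X \<and> B' = Y"
    by metis
  have X: "compact X" "closed X" "compact Y" "closed Y" "a \<in> X" "0 \<in> Y" "X + Y \<subseteq> S"
    "c \<le> measure \<mu> X + measure \<mu> Y"
    using XY by (auto simp: admissible_def intro: compact_imp_closed)
  \<comment> \<open>The Dyson transform of a maximal pair by any \<open>e \<in> X\<close> is the pair itself.\<close>
  have "(+) e ` Y \<subseteq> X" if "e \<in> X" for e
  proof -
    have "(X \<union> (+) e ` Y, Y \<inter> (+) (- e) ` X) \<in> admissible S c a"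
    proof -
      have "X \<union> (+) e ` Y + Y \<inter> (+) (- e) ` X \<subseteq> X + Y"
      proof
        fix z assume "z \<in> X \<union> (+) e ` Y + Y \<inter> (+) (- e) ` X"
        then obtain x y where z: "z = x + y" "x \<in> X \<union> (+) e ` Y" "y \<in> Y" "y \<in> (+) (- e) ` X"
          by (auto elim!: set_plus_elim)
        show "z \<in> X + Y"
        proof (cases "x \<in> X")
          case True
          then show ?thesis using z by blast
        next
          \<comment> \<open>Here \<open>x = e + y'\<close> and \<open>y = x' - e\<close> with
            \<open>y'\<close> in \<open>Y\<close> and \<open>x'\<close> in \<open>X\<close>; the
            shifts cancel, giving \<open>x + y = x' + y'\<close>.\<close>
          case False
          then have "x - e \<in> Y" "y - (- e) \<in> X"
            using z(2,4) unfolding Un_iff mem_image_plus_iff by blast+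
          then have "(y - (- e)) + (x - e) \<in> X + Y" by (rule set_plus_intro[rotated])
          then show ?thesis by (simp add: z(1) add.commute)
        qed
      qed
      moreover have "compact (X \<union> (+) e ` Y)" "compact (Y \<inter> (+) (- e) ` X)"
        using X(1-4) by (intro compact_Un compact_Int_closed closed_image_plus compact_image_plus; simp)+
      ultimately show ?thesis
        using X that measure_transform[OF X(1,3), of e]
        unfolding admissible_def by (auto simp: mem_image_plus_iff simp del: add_uminus_conv_diff)
    qed
    from max[OF this] show ?thesis by auto
  qed
  then have "X + Y \<subseteq> X" by (auto elim!: set_plus_elim)
  have "X \<subseteq> S"
    using set_zero_plus2[OF X(6), of X] X(7) by (auto simp: add.commute)
  show ?thesis
  proof (cases "measure \<mu> Y > 0")
    case True
    then have "open X"
      using open_of_plus_subset X(1,3) \<open>X + Y \<subseteq> X\<close> by blast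
    then show ?thesis using X(5) \<open>X \<subseteq> S\<close> by blast
  next
    case False
    then have "measure \<mu> Y = 0" by (simp add: zero_less_measure_iff)
    moreover have "measure \<mu> X \<le> measure \<mu> S"
      using \<open>X \<subseteq> S\<close> \<open>closed S\<close> by (intro finite_measure_mono) auto
    ultimately show ?thesis using X(8) by (simp add: c_def)
  qed
qed

theorem measure_set_plus_or_open:
  fixes A B :: "'a set"
  assumes "compact A" "compact B"
  shows "measure \<mu> A + measure \<mu> B \<le> measure \<mu> (A + B) \<or> open (A + B)"
proof (rule disjCI)
  assume "\<not> open (A + B)"
  then obtain s where s: "s \<in> A + B" "\<nexists>N. open N \<and> s \<in> N \<and> N \<subseteq> A + B"
    using open_subopen by metis
  then obtain a b where ab: "a \<in> A" "b \<in> B" "s = a + b"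
    by (auto elim: set_plus_elim)
  \<comment> \<open>Opposite shifts preserve the sumset, move \<open>b\<close> to 0 and
    \<open>a\<close> to \<open>s\<close>, as the local form at \<open>s\<close> requires.\<close>
  let ?A = "(+) b ` A" and ?B = "(+) (- b) ` B"
  have "?A + ?B \<subseteq> A + B"
  proof
    fix z assume "z \<in> ?A + ?B"
    then obtain x y where xy: "z = x + y" "x \<in> ?A" "y \<in> ?B"
      by (rule set_plus_elim)
    then have "(x - b) + (y - (- b)) \<in> A + B"
      unfolding mem_image_plus_iff by (intro set_plus_intro)
    then show "z \<in> A + B" by (simp add: xy(1))
  qed
  moreover have "compact ?A" "compact ?B" "closed (A + B)"
    using assms by (simp_all only: compact_image_plus compact_imp_closed compact_set_plus)
  moreover have "s \<in> ?A" "0 \<in> ?B"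
    unfolding mem_image_plus_iff using ab by simp_all
  ultimately have "measure \<mu> ?A + measure \<mu> ?B \<le> measure \<mu> (A + B)"
    using measure_set_plus_or_nhd[of ?A ?B s "A + B"] s(2) by blast
  then show "measure \<mu> A + measure \<mu> B \<le> measure \<mu> (A + B)"
    using assms(1,2) by (simp only: measure_image_plus borel_closed compact_imp_closed)
qed

end

section \<open>Iterated sumsets, stabilizers and open subgroups\<close>

lemma ksum_1 [simp]: "ksum (Suc 0) A = A"
proof -
  have "x \<in> ksum (Suc 0) A" if "x \<in> A" for x
    using that by (auto simp: ksum_def intro!: exI[of _ "\<lambda>_. x"])
  then show ?thesis by (auto simp: ksum_def)
qed

lemma ksum_Suc: "ksum (Suc k) A = ksum k A + A"
proof
  show "ksum (Suc k) A \<subseteq> ksum k A + A"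
    by (fastforce simp: ksum_def)
  show "ksum k A + A \<subseteq> ksum (Suc k) A"
  proof
    fix z assume "z \<in> ksum k A + A"
    then obtain f a where f: "z = (\<Sum>i<k. f i) + a" "\<forall>i<k. f i \<in> A" "a \<in> A"
      by (auto simp: ksum_def elim!: set_plus_elim)
    then have "z = (\<Sum>i<Suc k. (f(k := a)) i) \<and> (\<forall>i<Suc k. (f(k := a)) i \<in> A)"
      by simp
    then show "z \<in> ksum (Suc k) A"
      unfolding ksum_def by blast
  qed
qed

lemma compact_ksum:
  assumes "k \<ge> 1" "compact (A :: 'a::topological_ab_group_add set)"
  shows "compact (ksum k A)"
  using assms(1)
proof (induction k rule: nat_induct_at_least)
  case (Suc k)
  then show ?case using assms(2) by (simp add: ksum_Suc compact_set_plus)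
qed (use assms(2) in simp)

lemma ksum_empty: "k \<ge> 1 \<Longrightarrow> ksum k {} = {}"
  by (auto simp: ksum_def dest: spec[of _ 0])

lemma ksum_image:
  assumes add: "\<And>x y. f (x + y) = f x + f y" and "f 0 = 0"
  shows "ksum k (f ` A) = f ` ksum k A"
proof (induction k)
  case 0
  then show ?case using \<open>f 0 = 0\<close> by (auto simp: ksum_def)
next
  case (Suc k)
  have "f ` X + f ` Y = f ` (X + Y)" for X Y
    by (force simp: set_plus_def add[symmetric])
  then show ?case by (simp add: ksum_Suc Suc)
qed

lemma lambda_kl_commute: "lambda_kl k l \<mu> = lambda_kl l k \<mu>"
  by (simp add: lambda_kl_def Int_commute)

text \<open>The subgroup of periods of \<open>W\<close>, that is, of the \<open>h\<close> with
  \<open>W + h = W\<close>. The equivalence builds in both inclusions.\<close>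

definition stabilizer :: "'a::ab_group_add set \<Rightarrow> 'a set" where
  "stabilizer W = {h. \<forall>x. x + h \<in> W \<longleftrightarrow> x \<in> W}"

lemma zero_mem_stabilizer: "0 \<in> stabilizer W"
  by (simp add: stabilizer_def)

lemma diff_mem_stabilizer:
  assumes "g \<in> stabilizer W" "h \<in> stabilizer W"
  shows "g - h \<in> stabilizer W"
  unfolding stabilizer_def
proof clarify
  fix x
  have "x + (g - h) \<in> W \<longleftrightarrow> (x + (g - h)) + h \<in> W"
    using assms(2) unfolding stabilizer_def by blast
  also have "\<dots> \<longleftrightarrow> x + g \<in> W" by simp
  also have "\<dots> \<longleftrightarrow> x \<in> W"
    using assms(1) unfolding stabilizer_def by blast
  finally show "x + (g - h) \<in> W \<longleftrightarrow> x \<in> W" .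
qed

lemma add_mem_stabilizer:
  "g \<in> stabilizer W \<Longrightarrow> h \<in> stabilizer W \<Longrightarrow> g + h \<in> stabilizer W"
  by (simp add: stabilizer_def add.assoc[symmetric])

text \<open>The periods contributed by the summands add up to a single period.\<close>

lemma ksum_plus_stabilizer:
  assumes "z \<in> ksum k (A + stabilizer W)"
  obtains a h where "z = a + h" "a \<in> ksum k A" "h \<in> stabilizer W"
proof -
  have "ksum k (A + stabilizer W) \<subseteq> ksum k A + stabilizer W"
  proof (induction k)
    case 0
    then show ?case
      using zero_mem_stabilizer by (auto simp: ksum_def set_plus_def)
  next
    case (Suc k)
    show ?case
    proof
      fix z assume "z \<in> ksum (Suc k) (A + stabilizer W)"
      then obtain x y where "z = x + y" "x \<in> ksum k A + stabilizer W" "y \<in> A + stabilizer W"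
        using Suc unfolding ksum_Suc by (auto elim!: set_plus_elim)
      then obtain a g b h where "z = (a + g) + (b + h)" "a \<in> ksum k A" "b \<in> A"
        "g \<in> stabilizer W" "h \<in> stabilizer W"
        by (auto elim!: set_plus_elim)
      moreover have "(a + g) + (b + h) = (a + b) + (g + h)"
        by (simp add: algebra_simps)
      ultimately show "z \<in> ksum (Suc k) A + stabilizer W"
        unfolding ksum_Suc by (simp only: set_plus_intro add_mem_stabilizer)
    qed
  qed
  with assms show thesis
    using that by (auto elim: set_plus_elim)
qed

text \<open>The complement is a union of cosets of \<open>H\<close>, hence open.\<close>

lemma closed_of_open_subgroup:
  fixes H :: "'a::topological_ab_group_add set"
  assumes "open H" "0 \<in> H" "\<And>x y. x \<in> H \<Longrightarrow> y \<in> H \<Longrightarrow> x - y \<in> H"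
  shows "closed H"
proof -
  have "z \<notin> H" if "z \<in> - H + H" for z
  proof
    assume "z \<in> H"
    obtain x h where "z = x + h" "x \<notin> H" "h \<in> H"
      using \<open>z \<in> - H + H\<close> by (auto elim: set_plus_elim)
    then show False using assms(3)[OF \<open>z \<in> H\<close>, of h] by simp
  qed
  then have "- H + H = - H"
    using set_zero_plus2[OF \<open>0 \<in> H\<close>, of "- H"] by (auto simp: add.commute)
  then show ?thesis
    using open_set_plus[OF \<open>open H\<close>, of "- H"] by (simp add: closed_def)
qed

lemma identity_component_subset:
  fixes H :: "'a::topological_ab_group_add set"
  assumes "open H" "closed H" "0 \<in> H"
  shows "identity_component \<subseteq> H"
proof
  fix x :: 'a assume "x \<in> identity_component"
  then obtain T where T: "connected T" "0 \<in> T" "x \<in> T"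
    by (auto simp: identity_component_def connected_component_def)
  then show "x \<in> H"
    using connectedD[OF T(1) assms(1), of "- H"] assms by auto
qed

section \<open>Measures of iterated sumsets, open stabilizers and coset counting\<close>

context compact_haar
begin

text \<open>Induction with the weak Kneser bound; openness, once reached, persists when further
  copies of \<open>A\<close> are added.\<close>

lemma measure_ksum_or_open:
  fixes A :: "'a set"
  assumes "compact A" "k \<ge> 1"
  shows "real k * measure \<mu> A \<le> measure \<mu> (ksum k A) \<or> open (ksum k A)"
  using \<open>k \<ge> 1\<close>
proof (induction k rule: nat_induct_at_least)
  case (Suc k)
  have "measure \<mu> (ksum k A) + measure \<mu> A \<le> measure \<mu> (ksum (Suc k) A) \<or> open (ksum (Suc k) A)"
    unfolding ksum_Suc using Suc.hyps \<open>compact A\<close>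
    by (intro measure_set_plus_or_open compact_ksum)
  moreover have "open (ksum (Suc k) A)" if "open (ksum k A)"
    using open_set_plus[OF that, of A] by (simp add: ksum_Suc add.commute)
  ultimately show ?case
    using Suc.IH by (auto simp: algebra_simps)
qed simp

text \<open>A compact open set absorbs a neighbourhood \<open>V\<close> of 0. Intersecting
  \<open>V\<close> with its negative makes the inclusion reversible, so the result consists of
  periods; translation carries it to any other period.\<close>

lemma open_stabilizer:
  fixes W :: "'a set"
  assumes "open W" "closed W"
  shows "open (stabilizer W)"
proof (subst open_subopen, intro ballI)
  fix h assume h: "h \<in> stabilizer W"
  obtain V where V: "open V" "0 \<in> V" "V + W \<subseteq> W"
    using exists_nhd_plus_subset[OF closed_imp_compact[OF assms(2)] assms(1)] by blast
  define N where "N = V \<inter> uminus -` V"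
  have "open N" unfolding N_def
    using V(1) by (intro open_Int open_vimage continuous_intros)
  have "N \<subseteq> stabilizer W"
    unfolding stabilizer_def
  proof clarify
    fix v x assume "v \<in> N"
    then have v: "v \<in> V" "- v \<in> V" by (auto simp: N_def)
    have "x \<in> W" if "x + v \<in> W"
    proof -
      have "- v + (x + v) \<in> W" using V(3) v(2) that by blast
      then show ?thesis by (simp add: algebra_simps)
    qed
    moreover have "x + v \<in> W" if "x \<in> W"
      using V(3) v(1) that by (subst add.commute) blast
    ultimately show "x + v \<in> W \<longleftrightarrow> x \<in> W" by blast
  qed
  then have "(+) h ` N \<subseteq> stabilizer W"
    using h by (auto intro: add_mem_stabilizer)
  moreover have "h \<in> (+) h ` N"
    using V(2) by (simp add: mem_image_plus_iff N_def)
  ultimately show "\<exists>T. open T \<and> h \<in> T \<and> T \<subseteq> stabilizer W"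
    using open_image_plus[OF \<open>open N\<close>] by blast
qed

text \<open>A minimal subfamily of a finite cover by cosets has no repeated coset.\<close>

lemma finite_coset_partition:
  fixes H :: "'a set"
  assumes "open H" "0 \<in> H" and diff: "\<And>x y. x \<in> H \<Longrightarrow> y \<in> H \<Longrightarrow> x - y \<in> H"
  obtains R where "finite R" "(\<Union>r\<in>R. (+) r ` H) = UNIV"
    "\<And>r s. r \<in> R \<Longrightarrow> s \<in> R \<Longrightarrow> r - s \<in> H \<Longrightarrow> r = s"
proof -
  obtain F where F: "finite F" "(\<Union>x\<in>F. (+) x ` H) = UNIV"
    using finite_translate_cover[OF assms(1,2)] .
  define Cov where "Cov = {R. R \<subseteq> F \<and> (\<Union>x\<in>R. (+) x ` H) = UNIV}"
  have "finite Cov" "Cov \<noteq> {}" using F by (auto simp: Cov_def)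
  then obtain R where "R \<in> Cov" and min: "\<And>S. S \<in> Cov \<Longrightarrow> S \<subseteq> R \<Longrightarrow> R = S"
    using finite_has_minimal by metis
  then have R: "R \<subseteq> F" "(\<Union>x\<in>R. (+) x ` H) = UNIV"
    by (simp_all add: Cov_def)
  show thesis
  proof
    show "finite R" using F(1) R(1) by (rule rev_finite_subset)
    show "(\<Union>r\<in>R. (+) r ` H) = UNIV" by (fact R(2))
    fix r s assume rs: "r \<in> R" "s \<in> R" "r - s \<in> H"
    show "r = s"
    proof (rule ccontr)
      assume "r \<noteq> s"
      have "y \<in> (\<Union>x\<in>R - {r}. (+) x ` H)" for y
      proof -
        obtain x where x: "x \<in> R" "y - x \<in> H"
          using R(2) unfolding set_eq_iff UN_iff mem_image_plus_iff by blast
        show ?thesis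
        proof (cases "x = r")
          case True
          \<comment> \<open>This is \<open>(y - r) + (r - s)\<close>, written with differences only,
            the operation under which \<open>H\<close> is assumed closed.\<close>
          have "(y - x) - (0 - (r - s)) \<in> H"
            using diff x(2) rs(3) assms(2) by blast
          then have "y - s \<in> H" using True by simp
          then show ?thesis using rs(2) \<open>r \<noteq> s\<close> unfolding UN_iff mem_image_plus_iff by blast
        next
          case False
          then show ?thesis using x unfolding UN_iff mem_image_plus_iff by blast
        qed
      qed
      then have "R - {r} \<in> Cov" using R(1) by (auto simp only: Cov_def)
      then have "R = R - {r}" by (intro min) auto
      then show False using rs(1) by blast
    qed
  qed
qed

text \<open>The translates of \<open>C\<close> have equal measure and together fill the group. The
  map \<open>f\<close> allows the same index sets \<open>R\<close> and \<open>T\<close> to count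
  cosets both in a group and in its quotient.\<close>

lemma measure_UN_cosets:
  fixes f :: "'i \<Rightarrow> 'a"
  assumes "finite R" "closed C" "(\<Union>r\<in>R. (+) (f r) ` C) = UNIV"
    and disj: "disjoint_family_on (\<lambda>r. (+) (f r) ` C) R" and "T \<subseteq> R"
  shows "measure \<mu> (\<Union>r\<in>T. (+) (f r) ` C) = card T / card R"
proof -
  have meas: "measure \<mu> (\<Union>r\<in>S. (+) (f r) ` C) = card S * measure \<mu> C" if "S \<subseteq> R" for S
  proof -
    have "measure \<mu> (\<Union>r\<in>S. (+) (f r) ` C) = (\<Sum>r\<in>S. measure \<mu> ((+) (f r) ` C))"
      using assms(1,2) disj that
      by (intro finite_measure_finite_Union)
        (auto intro: finite_subset borel_closed closed_image_plus elim: disjoint_family_on_mono)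
    then show ?thesis using assms(2) by (simp add: measure_image_plus)
  qed
  from meas[of R] have "card R * measure \<mu> C = 1" using assms(3) by simp
  then show ?thesis
    using meas[OF \<open>T \<subseteq> R\<close>] by (metis eq_divide_imp mult.assoc mult.commute mult_1_right zero_neq_one mult_zero_left)
qed

section \<open>Transfer of sum-free sets to a quotient\<close>

lemma measure_le_lambda_kl:
  assumes "A \<in> sets borel" "ksum k A \<inter> ksum l A = {}"
  shows "measure \<mu> A \<le> lambda_kl k l \<mu>"
  unfolding lambda_kl_def
proof (rule cSup_upper)
  show "bdd_above {measure \<mu> A |A. A \<in> sets \<mu> \<and> ksum k A \<inter> ksum l A = {}}"
    by (rule bdd_aboveI[of _ 1]) (auto intro: measure_le_1)
qed (use assms in auto)

end

text \<open>The stabilizer of the open sumset contains the kernel of \<open>\<pi>\<close>, so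
  \<open>A\<close> can be enlarged to a union of cosets that descends to \<open>'m\<close> with its
  measure. Only the first sumset is taken open; the other case follows by exchanging
  \<open>k\<close> and \<open>l\<close>.\<close>

lemma measure_le_lambda_kl_quotient:
  fixes \<mu>G :: "'g::{topological_ab_group_add, t2_space} measure"
    and \<mu>M :: "'m::{topological_ab_group_add, t2_space} measure"
    and \<pi> :: "'g \<Rightarrow> 'm"
  assumes "compact_haar \<mu>G" "compact_haar \<mu>M"
    and cont: "continuous_on UNIV \<pi>" and add: "\<And>x y. \<pi> (x + y) = \<pi> x + \<pi> y" and "surj \<pi>"
    and ker: "\<And>z. \<pi> z = 0 \<Longrightarrow> z \<in> identity_component"
    and A: "compact A" "ksum k A \<inter> ksum l A = {}" "k \<ge> 1" "open (ksum k A)"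
  shows "measure \<mu>G A \<le> lambda_kl k l \<mu>M"
proof -
  interpret G: compact_haar \<mu>G by fact
  interpret M: compact_haar \<mu>M by fact
  have \<pi>0: "\<pi> 0 = 0" using add[of 0 0] by simp
  have \<pi>diff: "\<pi> (x - y) = \<pi> x - \<pi> y" for x y
    using add[of "x - y" y] by simp
  define W where "W = ksum k A"
  define H where "H = stabilizer W"
  have "closed W"
    unfolding W_def using A(1,3) by (intro compact_imp_closed compact_ksum)
  then have "open H"
    using A(4) unfolding H_def W_def by (rule G.open_stabilizer[rotated])
  have H: "0 \<in> H" "\<And>x y. x \<in> H \<Longrightarrow> y \<in> H \<Longrightarrow> x - y \<in> H"
    unfolding H_def by (rule zero_mem_stabilizer, rule diff_mem_stabilizer)
  have "closed H" using closed_of_open_subgroup \<open>open H\<close> H by blast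
  then have ker_H: "z \<in> H" if "\<pi> z = 0" for z
    using ker[OF that] identity_component_subset \<open>open H\<close> H(1) by blast
  have "compact H" using \<open>closed H\<close> by (rule G.closed_imp_compact)
  define B where "B = A + H"
  have "compact B" unfolding B_def using A(1) \<open>compact H\<close> by (rule compact_set_plus)
  have "A \<subseteq> B"
    unfolding B_def using set_zero_plus2[OF H(1), of A] by (simp add: add.commute)
  \<comment> \<open>Passing from \<open>A\<close> to \<open>B\<close> changes a sum only by a period
    of \<open>W\<close>, so the \<open>k\<close>-fold sums stay in \<open>W\<close> and the
    \<open>l\<close>-fold sums stay outside.\<close>
  have ksum_B: "\<exists>a\<in>ksum i A. z \<in> W \<longleftrightarrow> a \<in> W" if z: "z \<in> ksum i B" for i z
  proof -
    obtain a h where "z = a + h" "a \<in> ksum i A" "h \<in> stabilizer W"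
      using z unfolding B_def H_def by (rule ksum_plus_stabilizer)
    then show ?thesis by (auto simp: stabilizer_def)
  qed
  have "ksum k B \<subseteq> W"
    using ksum_B[of _ k] by (auto simp: W_def)
  have "ksum l B \<inter> W = {}"
    using ksum_B[of _ l] A(2) by (fastforce simp: W_def)
  \<comment> \<open>Sums with equal images differ by an element of the kernel, hence by a period of
    \<open>W\<close>, which cannot lead from inside \<open>W\<close> to outside.\<close>
  have "ksum k (\<pi> ` B) \<inter> ksum l (\<pi> ` B) = {}"
  proof (rule ccontr)
    assume "\<not> ?thesis"
    then obtain x y where xy: "x \<in> ksum k B" "y \<in> ksum l B" "\<pi> x = \<pi> y"
      unfolding ksum_image[of \<pi>, OF add \<pi>0] by auto
    then have "y - x \<in> H" by (intro ker_H) (simp add: \<pi>diff)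
    then have "x + (y - x) \<in> W"
      using xy(1) \<open>ksum k B \<subseteq> W\<close> unfolding H_def stabilizer_def by blast
    then show False using xy(2) \<open>ksum l B \<inter> W = {}\<close> by auto
  qed
  moreover have "compact (\<pi> ` X)" if "compact X" for X
    using compact_continuous_image continuous_on_subset[OF cont] that by blast
  then have "closed (\<pi> ` H)" "\<pi> ` B \<in> sets borel"
    using \<open>compact H\<close> \<open>compact B\<close> by (auto intro: compact_imp_closed borel_closed)
  ultimately have "measure \<mu>M (\<pi> ` B) \<le> lambda_kl k l \<mu>M"
    by (intro M.measure_le_lambda_kl)
  \<comment> \<open>Both sides equal \<open>card T / card R\<close>: since the kernel lies in
    \<open>H\<close>, distinct cosets of \<open>H\<close> have disjoint images.\<close>
  moreover have "measure \<mu>G B = measure \<mu>M (\<pi> ` B)"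
  proof -
    obtain R where R: "finite R" "(\<Union>r\<in>R. (+) r ` H) = UNIV"
      and R_eq: "\<And>r s. r \<in> R \<Longrightarrow> s \<in> R \<Longrightarrow> r - s \<in> H \<Longrightarrow> r = s"
      using G.finite_coset_partition[OF \<open>open H\<close> H] by metis
    define T where "T = R \<inter> B"
    have image: "\<pi> ` (+) r ` H = (+) (\<pi> r) ` \<pi> ` H" for r
      by (simp add: image_image add)
    have "r + h \<in> B \<longleftrightarrow> r \<in> B" if "h \<in> H" for r h
    proof
      assume "r \<in> B"
      then obtain a g where "r = a + g" "a \<in> A" "g \<in> H"
        unfolding B_def by (rule set_plus_elim)
      then show "r + h \<in> B"
        using that add_mem_stabilizer unfolding B_def H_def by (metis add.assoc set_plus_intro)
    next
      assume "r + h \<in> B"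
      then obtain a g where "r + h = a + g" "a \<in> A" "g \<in> H"
        unfolding B_def by (rule set_plus_elim)
      moreover from this have "r = a + (g - h)" by (simp add: algebra_simps)
      ultimately show "r \<in> B"
        using H(2) that unfolding B_def by (simp only: set_plus_intro)
    qed
    then have B_eq: "B = (\<Union>r\<in>T. (+) r ` H)"
      using R(2) unfolding T_def by fastforce
    have "disjoint_family_on (\<lambda>r. (+) (\<pi> r) ` \<pi> ` H) R"
    proof (unfold disjoint_family_on_def, intro ballI impI, rule ccontr)
      fix r s assume rs: "r \<in> R" "s \<in> R" "r \<noteq> s"
        "(+) (\<pi> r) ` \<pi> ` H \<inter> (+) (\<pi> s) ` \<pi> ` H \<noteq> {}"
      then obtain g h where gh: "g \<in> H" "h \<in> H" "\<pi> (r + g) = \<pi> (s + h)"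
        by (auto simp: add)
      then have "(r + g) - (s + h) \<in> H"
        by (intro ker_H) (simp add: \<pi>diff)
      then have "((r + g) - (s + h)) - (g - h) \<in> H"
        using H(2) gh(1,2) by blast
      then have "r - s \<in> H" by (simp add: algebra_simps)
      then show False using R_eq rs by blast
    qed
    moreover from this have "disjoint_family_on (\<lambda>r. (+) r ` H) R"
      unfolding disjoint_family_on_def image[symmetric] by blast
    moreover have "(\<Union>r\<in>R. (+) (\<pi> r) ` \<pi> ` H) = UNIV"
      unfolding image[symmetric] image_UN[symmetric] R(2) by fact
    moreover have "\<pi> ` B = (\<Union>r\<in>T. (+) (\<pi> r) ` \<pi> ` H)"
      unfolding B_eq image_UN image ..
    moreover have "T \<subseteq> R" by (simp add: T_def)
    ultimately show ?thesis
      using G.measure_UN_cosets[of R H id T] M.measure_UN_cosets[of R "\<pi> ` H" \<pi> T]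
        R \<open>closed H\<close> \<open>closed (\<pi> ` H)\<close> B_eq by simp
  qed
  moreover have "measure \<mu>G A \<le> measure \<mu>G B"
    using \<open>A \<subseteq> B\<close> \<open>compact B\<close>
    by (intro G.finite_measure_mono) (auto intro: borel_closed compact_imp_closed)
  ultimately show ?thesis by simp
qed

section \<open>The bound for compact sum-free sets and its extension to measurable ones\<close>

theorem theorem2p4:
  fixes k l :: nat
    and \<mu>G :: "'g::{topological_ab_group_add, t2_space} measure"
    and \<mu>M :: "'m::{topological_ab_group_add, t2_space} measure"
    and \<phi> :: "'g \<Rightarrow> 'g \<times> 'm"
  assumes "1 \<le> k" and "k < l"
    and "compact (UNIV :: 'g set)" and "compact (UNIV :: 'm set)"
    and "haar_prob \<mu>G" and "haar_prob \<mu>M"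
    and "splits_as_component_times \<phi>"
  shows "lambda_kl k l \<mu>G \<le> max (lambda_kl k l \<mu>M) (1 / (real k + real l))"
proof -
  interpret G: compact_haar \<mu>G by unfold_locales fact+
  interpret M: compact_haar \<mu>M by unfold_locales fact+
  obtain \<psi> where \<psi>: "homeomorphism UNIV (identity_component \<times> UNIV) \<phi> \<psi>"
    and add: "\<phi> (x + y) = \<phi> x + \<phi> y"
    and comp: "\<phi> ` identity_component = identity_component \<times> {0}" for x y
    using \<open>splits_as_component_times \<phi>\<close> unfolding splits_as_component_times_def by blast
  \<comment> \<open>The projection to the second factor; its kernel lies in the identity component
    because \<open>\<phi>\<close> is injective and maps that component onto the first
    factor.\<close>
  define \<pi> where "\<pi> = snd \<circ> \<phi>"
  have range: "range \<phi> = identity_component \<times> UNIV" and inj: "\<psi> (\<phi> x) = x" for x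
    using \<psi> by (auto simp: homeomorphism_def)
  have "continuous_on UNIV \<pi>"
    unfolding \<pi>_def using homeomorphism_cont1[OF \<psi>]
    by (intro continuous_on_compose continuous_on_snd continuous_on_id)
  moreover have "\<pi> (x + y) = \<pi> x + \<pi> y" for x y
    by (simp add: \<pi>_def add)
  moreover have "surj \<pi>"
  proof -
    have "0 \<in> (identity_component :: 'g set)"
      by (simp add: identity_component_def)
    then show ?thesis
      unfolding \<pi>_def image_comp[symmetric] range by force
  qed
  moreover have "z \<in> identity_component" if "\<pi> z = 0" for z
  proof -
    have "\<phi> z \<in> identity_component \<times> {0}"
      using range that unfolding \<pi>_def by (metis comp_apply mem_Sigma_iff prod.collapse rangeI singletonI)
    then show ?thesis unfolding comp[symmetric] by (metis imageE inj)
  qed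
  ultimately have quotient: "measure \<mu>G A \<le> lambda_kl i j \<mu>M"
    if "compact A" "ksum i A \<inter> ksum j A = {}" "i \<ge> 1" "open (ksum i A)" for A i j
    using that measure_le_lambda_kl_quotient[OF G.compact_haar_axioms M.compact_haar_axioms] by blast
  have compact_bound: "measure \<mu>G A \<le> max (lambda_kl k l \<mu>M) (1 / (real k + real l))"
    if A: "compact A" "ksum k A \<inter> ksum l A = {}" for A
  \<comment> \<open>An open sumset leads to \<open>\<mu>M\<close>, with \<open>k\<close> and
    \<open>l\<close> exchanged if it is the \<open>l\<close>-fold one; otherwise both sumsets are
    large and, being disjoint, share total measure 1.\<close>
  proof (cases "open (ksum k A) \<or> open (ksum l A)")
    case True
    then show ?thesis
      using quotient[of A k l] quotient[of A l k] A \<open>1 \<le> k\<close> \<open>k < l\<close>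
      by (auto simp: lambda_kl_commute[of l k] Int_commute le_max_iff_disj)
  next
    case False
    have meas: "ksum k A \<in> sets borel" "ksum l A \<in> sets borel"
      using A(1) \<open>1 \<le> k\<close> \<open>k < l\<close> by (auto intro!: borel_closed compact_imp_closed compact_ksum)
    have "real k * measure \<mu>G A + real l * measure \<mu>G A \<le> measure \<mu>G (ksum k A) + measure \<mu>G (ksum l A)"
      using G.measure_ksum_or_open[OF A(1), of k] G.measure_ksum_or_open[OF A(1), of l]
        False \<open>1 \<le> k\<close> \<open>k < l\<close> by auto
    also have "\<dots> = measure \<mu>G (ksum k A \<union> ksum l A)"
      using G.finite_measure_Union[of "ksum k A" "ksum l A"] meas A(2) by simp
    also have "\<dots> \<le> 1"
      using meas by (intro G.measure_le_1) auto
    finally have "measure \<mu>G A \<le> 1 / (real k + real l)"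
      using \<open>k < l\<close> by (simp add: field_simps)
    then show ?thesis by simp
  qed
  show ?thesis
    unfolding lambda_kl_def[of k l \<mu>G]
  proof (rule cSup_least)
    \<comment> \<open>The empty set qualifies: as \<open>k\<close> is positive, its
      \<open>k\<close>-fold sumset is empty.\<close>
    show "{measure \<mu>G A |A. A \<in> sets \<mu>G \<and> ksum k A \<inter> ksum l A = {}} \<noteq> {}"
      using ksum_empty[OF \<open>1 \<le> k\<close>] by (auto intro!: exI[of _ "{}"])
    fix x assume "x \<in> {measure \<mu>G A |A. A \<in> sets \<mu>G \<and> ksum k A \<inter> ksum l A = {}}"
    then obtain A where A: "x = measure \<mu>G A" "A \<in> sets borel" "ksum k A \<inter> ksum l A = {}"
      by auto
    show "x \<le> max (lambda_kl k l \<mu>M) (1 / (real k + real l))"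
    \<comment> \<open>Inner regularity reduces to compact sets, since subsets inherit disjointness
      of the two sumsets.\<close>
    proof (rule field_le_epsilon)
      fix e :: real assume "e > 0"
      then obtain K where K: "compact K" "K \<subseteq> A" "measure \<mu>G A < measure \<mu>G K + e"
        using G.inner_regular[OF A(2)] by blast
      have "ksum j K \<subseteq> ksum j A" for j
        using K(2) by (fastforce simp: ksum_def)
      then have "ksum k K \<inter> ksum l K = {}" using A(3) by blast
      from compact_bound[OF K(1) this] K(3) A(1)
      show "x \<le> max (lambda_kl k l \<mu>M) (1 / (real k + real l)) + e" by linarith
    qed
  qed
qed

end
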